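(* Let $k\ge 1$ and let $v_1,\dots,v_k$ be distinct vertices of a graph $G$ satisfying $N[v_1]=\cdots=N[v_k]$. Let $w$ be another vertex of $G$ (distinct from all the $v_j$) that is not adjacent to any $v_j$. Define $G_0=G$ and $G_j=G_{j-1}+v_jw$ for $1\le j\le k$. Then $(X_{G_j})_{j=0}^k$ is an arithmetic progression in $\mathrm{Sym}$. In particular, if $\{b_\lambda\}_{\lambda\vdash n\ge 0}$ is any basis of $\mathrm{Sym}$ and $X_{G_0}$ and $X_{G_k}$ are $b$-positive, then $X_{G_j}$ is $b$-positive for every $0\le j\le k$.
   Context: All graphs are finite and simple with nonempty vertex set. For a vertex $v$, $N(v)$ is the set of vertices adjacent to $v$, and $N[v]=N(v)\cup\{v\}$. $G+vw$ denotes the graph obtained from $G$ by adding an edge between $v$ and $w$. A proper colouring of $G$ is a map $\kappa:V(G)\to\mathbb Z_{>0}$ with $\kappa(u)\ne\kappa(v)$ whenever $uv\in E(G)$. The chromatic symmetric function of $G$ with vertex set $\{u_1,\dots,u_d\}$ is $X_G=\sum_\kappa x_{\kappa(u_1)}\cdots x_{\kappa(u_d)}$, in commuting variables $x_1,x_2,\dots$, summed over all proper colourings $\kappa$ of $G$. $\mathrm{Sym}\subseteq\mathbb Q[[x_1,x_2,\dots]]$ is the algebra of symmetric functions over $\mathbb Q$. An element is $b$-positive if all coefficients in its expansion in the basis $\{b_\lambda\}$ are nonnegative. *)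

theory Defs
  imports Complex_Main "HOL-Library.Multiset" "HOL-Library.FuncSet"
    "HOL-Library.Function_Algebras"
begin

record 'a graph =
  verts :: "'a set"
  edges :: "'a set set"

definition simple_graph :: "'a graph \<Rightarrow> bool" where
  "simple_graph G \<longleftrightarrow> finite (verts G) \<and> verts G \<noteq> {} \<and>
     (\<forall>e\<in>edges G. e \<subseteq> verts G \<and> card e = 2)"

definition nbhd :: "'a graph \<Rightarrow> 'a \<Rightarrow> 'a set" where
  "nbhd G v = {u \<in> verts G. {u, v} \<in> edges G}"

definition closed_nbhd :: "'a graph \<Rightarrow> 'a \<Rightarrow> 'a set" where
  "closed_nbhd G v = nbhd G v \<union> {v}"

definition add_edge :: "'a graph \<Rightarrow> 'a \<Rightarrow> 'a \<Rightarrow> 'a graph" where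
  "add_edge G v w = G\<lparr>edges := insert {v, w} (edges G)\<rparr>"

text \<open>
  Elements of \<open>\<rat>[[x\<^sub>1, x\<^sub>2, \<dots>]]\<close> are given by their coefficient functions. The variables are
  indexed by \<open>num\<close>, the type of positive integers, and a monomial is the multiset of (indices of)
  its variables. Addition, subtraction and zero are those of \<open>Function_Algebras\<close>; the pointwise
  product of that theory is not the product of power series and is not used.
\<close>

type_synonym monomial = "num multiset"
type_synonym power_series = "monomial \<Rightarrow> rat"

definition scale :: "rat \<Rightarrow> power_series \<Rightarrow> power_series" where
  "scale c f = (\<lambda>m. c * f m)"

global_interpretation ps: vector_space scale
  by unfold_locales (auto simp: scale_def fun_eq_iff algebra_simps)

text \<open>Symmetric functions: power series of bounded degree, invariant under permuting the variables.\<close>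

definition Sym :: "power_series set" where
  "Sym = {f. (\<exists>d. \<forall>m. f m \<noteq> 0 \<longrightarrow> size m \<le> d) \<and>
             (\<forall>\<sigma> m. bij \<sigma> \<longrightarrow> f (image_mset \<sigma> m) = f m)}"

lemma subspace_Sym: "ps.subspace Sym"
proof (rule ps.subspaceI)
  fix f g assume f: "f \<in> Sym" and g: "g \<in> Sym"
  from f obtain d where d: "\<And>m. f m \<noteq> 0 \<Longrightarrow> size m \<le> d" by (auto simp: Sym_def)
  from g obtain e where e: "\<And>m. g m \<noteq> 0 \<Longrightarrow> size m \<le> e" by (auto simp: Sym_def)
  have "size m \<le> max d e" if "(f + g) m \<noteq> 0" for m
    using that d[of m] e[of m] by (cases "f m = 0") (auto simp: max_def)
  moreover have "(f + g) (image_mset \<sigma> m) = (f + g) m" if "bij \<sigma>" for \<sigma> m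
    using f g that by (simp add: Sym_def)
  ultimately show "f + g \<in> Sym" by (auto simp: Sym_def simp del: plus_fun_apply)
qed (auto simp: Sym_def scale_def)

text \<open>Colourings are extensional functions, so that each map on the vertex set is counted once.\<close>

definition proper_colourings :: "'a graph \<Rightarrow> ('a \<Rightarrow> num) set" where
  "proper_colourings G =
     {\<kappa> \<in> verts G \<rightarrow>\<^sub>E UNIV. \<forall>u v. {u, v} \<in> edges G \<longrightarrow> \<kappa> u \<noteq> \<kappa> v}"

definition colouring_monomial :: "'a graph \<Rightarrow> ('a \<Rightarrow> num) \<Rightarrow> monomial" where
  "colouring_monomial G \<kappa> = image_mset \<kappa> (mset_set (verts G))"

text \<open>
  The formal sum of the monomials of all proper colourings: the coefficient of \<open>m\<close> is the number
  of proper colourings with monomial \<open>m\<close>, which is finite for a finite graph.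
\<close>

definition chromatic_symmetric_function :: "'a graph \<Rightarrow> power_series" where
  "chromatic_symmetric_function G =
     (\<lambda>m. of_nat (card {\<kappa> \<in> proper_colourings G. colouring_monomial G \<kappa> = m}))"

definition arithmetic_progression_in ::
    "power_series set \<Rightarrow> nat \<Rightarrow> (nat \<Rightarrow> power_series) \<Rightarrow> bool" where
  "arithmetic_progression_in S k a \<longleftrightarrow>
     (\<forall>j\<le>k. a j \<in> S) \<and> (\<exists>D\<in>S. \<forall>j<k. a (Suc j) - a j = D)"

text \<open>Integer partitions of all \<open>n \<ge> 0\<close>, as multisets of positive parts.\<close>

definition partitions :: "nat multiset set" where
  "partitions = {l. 0 \<notin># l}"

definition Sym_basis :: "(nat multiset \<Rightarrow> power_series) \<Rightarrow> bool" where
  "Sym_basis b \<longleftrightarrow> inj_on b partitions \<and> ps.independent (b ` partitions) \<and>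
     ps.span (b ` partitions) = Sym"

definition basis_positive :: "(nat multiset \<Rightarrow> power_series) \<Rightarrow> power_series \<Rightarrow> bool" where
  "basis_positive b f \<longleftrightarrow>
     f \<in> Sym \<and> (\<forall>l\<in>partitions. ps.representation (b ` partitions) f (b l) \<ge> 0)"

end

theory Submission
  imports Defs "HOL-Combinatorics.Transposition"
begin

text \<open>
  Since the \<open>v\<^sub>i\<close> form a clique, a proper colouring of \<open>G\<close> that gives \<open>v\<^sub>j\<close> and \<open>w\<close> the same
  colour gives \<open>w\<close> a colour different from that of every \<open>v\<^sub>i\<close> with \<open>i \<noteq> j\<close>. Hence the
  colourings lost in passing from \<open>G\<^sub>j\<^sub>-\<^sub>1\<close> to \<open>G\<^sub>j\<close> are exactly the proper colourings of \<open>G\<close> itself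
  with \<open>\<kappa>(v\<^sub>j) = \<kappa>(w)\<close>. As \<open>v\<^sub>i\<close> and \<open>v\<^sub>j\<close> are twins, the transposition exchanging them is an
  automorphism of \<open>G\<close> fixing \<open>w\<close>, so the generating function of the lost colourings does not
  depend on \<open>j\<close>. Finally \<open>X\<^sub>j\<close> is the convex combination of \<open>X\<^sub>0\<close> and \<open>X\<^sub>k\<close> with weights \<open>1 - j/k\<close> and \<open>j/k\<close>.
\<close>

lemma add_edge_simps [simp]:
  "verts (add_edge G v w) = verts G"
  "edges (add_edge G v w) = insert {v, w} (edges G)"
  by (simp_all add: add_edge_def)

lemma simple_graph_add_edge:
  assumes "simple_graph G" "v \<in> verts G" "w \<in> verts G" "v \<noteq> w"
  shows "simple_graph (add_edge G v w)"
  using assms by (auto simp: simple_graph_def)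

lemma simple_graph_edgeD:
  assumes "simple_graph G" "{a, b} \<in> edges G"
  shows "a \<in> verts G" "b \<in> verts G" "a \<noteq> b"
  using assms by (auto simp: simple_graph_def dest!: bspec[of _ _ "{a, b}"])

lemma proper_colourings_add_edge:
  "proper_colourings (add_edge G v w) = {\<kappa> \<in> proper_colourings G. \<kappa> v \<noteq> \<kappa> w}"
  by (auto simp: proper_colourings_def doubleton_eq_iff)

text \<open>Only colours occurring in \<open>m\<close> can be used, so such colourings map into a
  finite set. Finiteness makes \<open>card\<close> a genuine count, as needed when subtracting
  counts.\<close>

lemma finite_colourings_of_monomial:
  assumes "simple_graph G"
  shows "finite {\<kappa> \<in> proper_colourings G. colouring_monomial G \<kappa> = m}"
proof (rule finite_subset)
  have fin: "finite (verts G)"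
    using assms by (simp add: simple_graph_def)
  show "{\<kappa> \<in> proper_colourings G. colouring_monomial G \<kappa> = m} \<subseteq> verts G \<rightarrow>\<^sub>E set_mset m"
    using fin by (auto simp: proper_colourings_def colouring_monomial_def PiE_iff extensional_def)
  show "finite (verts G \<rightarrow>\<^sub>E set_mset m)"
    using fin by (intro finite_PiE) auto
qed

section \<open>Permuting colours and membership in \<open>Sym\<close>\<close>

lemma proper_colouring_permute_colours:
  assumes "simple_graph G" "inj \<sigma>" "\<kappa> \<in> proper_colourings G"
  shows "restrict (\<sigma> \<circ> \<kappa>) (verts G) \<in> proper_colourings G"
  using assms simple_graph_edgeD[OF assms(1)]
  by (auto simp: proper_colourings_def inj_eq)

lemma colouring_monomial_permute_colours:
  assumes "simple_graph G"
  shows "colouring_monomial G (restrict (\<sigma> \<circ> \<kappa>) (verts G)) = image_mset \<sigma> (colouring_monomial G \<kappa>)"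
proof -
  have "finite (verts G)"
    using assms by (simp add: simple_graph_def)
  then show ?thesis
    by (auto simp: colouring_monomial_def multiset.map_comp intro!: image_mset_cong)
qed

text \<open>Makes recolouring by a permutation invertible on extensional colourings. The
  \<open>restrict\<close> is there because a permutation may move the default value
  \<open>undefined\<close> taken outside the vertex set.\<close>

lemma restrict_comp_inverse:
  assumes "f \<in> extensional A" "\<And>x. g (h x) = x"
  shows "restrict (g \<circ> restrict (h \<circ> f) A) A = f"
  using assms by (auto simp: fun_eq_iff extensional_def)

text \<open>Every colouring monomial has degree equal to the number of vertices, and recolouring by
  \<sigma> matches the colourings counted by the two coefficients.\<close>

lemma chromatic_symmetric_function_in_Sym:
  assumes G: "simple_graph G"
  shows "chromatic_symmetric_function G \<in> Sym"
proof -
  let ?C = "\<lambda>m. {\<kappa> \<in> proper_colourings G. colouring_monomial G \<kappa> = m}"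
  have "size m \<le> card (verts G)" if "chromatic_symmetric_function G m \<noteq> 0" for m
  proof -
    have "?C m \<noteq> {}"
      using that by (auto simp: chromatic_symmetric_function_def simp del: Collect_empty_eq)
    then show ?thesis
      by (auto simp: colouring_monomial_def)
  qed
  moreover have "chromatic_symmetric_function G (image_mset \<sigma> m) = chromatic_symmetric_function G m"
    if "bij \<sigma>" for \<sigma> m
  proof -
    have inj: "inj \<sigma>" "inj (inv \<sigma>)"
      using that by (auto simp: bij_is_inj bij_imp_bij_inv)
    have inv: "\<sigma> (inv \<sigma> x) = x" "inv \<sigma> (\<sigma> x) = x" for x
      using that by (simp_all add: bij_is_surj surj_f_inv_f bij_is_inj)
    have inv_image: "image_mset (inv \<sigma>) (image_mset \<sigma> m) = m"
      by (simp add: multiset.map_comp comp_def inv)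
    have ext: "\<kappa> \<in> extensional (verts G)" if "\<kappa> \<in> proper_colourings G" for \<kappa>
      using that by (auto simp: proper_colourings_def PiE_def)
    have "bij_betw (\<lambda>\<kappa>. restrict (\<sigma> \<circ> \<kappa>) (verts G)) (?C m) (?C (image_mset \<sigma> m))"
      by (rule bij_betwI[where g = "\<lambda>\<kappa>. restrict (inv \<sigma> \<circ> \<kappa>) (verts G)"])
        (use inj inv_image in \<open>auto simp: G proper_colouring_permute_colours
          colouring_monomial_permute_colours ext restrict_comp_inverse inv\<close>)
    then show ?thesis
      by (simp add: chromatic_symmetric_function_def bij_betw_same_card)
  qed
  ultimately show ?thesis
    by (auto simp: Sym_def)
qed

section \<open>Twin vertices and the colourings lost with a new edge\<close>

lemma adjacent_twins:
  assumes "closed_nbhd G x = closed_nbhd G y" "x \<noteq> y"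
  shows "{x, y} \<in> edges G"
proof -
  have "x \<in> closed_nbhd G y"
    using assms(1) by (auto simp: closed_nbhd_def)
  then show ?thesis
    using assms(2) by (simp add: closed_nbhd_def nbhd_def)
qed

text \<open>An edge with exactly one end in \<open>{x, y}\<close> moves to the other twin, the edge
  \<open>{x, y}\<close> is preserved as a set, and all other edges are untouched.\<close>

lemma transpose_twins_edge:
  assumes G: "simple_graph G" and twins: "closed_nbhd G x = closed_nbhd G y"
    and ab: "{a, b} \<in> edges G"
  shows "{transpose x y a, transpose x y b} \<in> edges G"
proof -
  \<comment> \<open>Stated for fresh \<open>x\<close> and \<open>y\<close>, so that it serves both
    directions of the exchange.\<close>
  have twin: "{y, z} \<in> edges G"
    if "closed_nbhd G x = closed_nbhd G y" "{x, z} \<in> edges G" "z \<noteq> y" for x y z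
  proof -
    have "z \<in> closed_nbhd G x"
      using simple_graph_edgeD(2)[OF G that(2)] that(2)
      by (simp add: closed_nbhd_def nbhd_def insert_commute)
    then have "z \<in> nbhd G y"
      unfolding that(1) using that(3) by (simp add: closed_nbhd_def)
    then show ?thesis
      by (simp add: nbhd_def insert_commute)
  qed
  have "a \<noteq> b" and ba: "{b, a} \<in> edges G"
    using simple_graph_edgeD(3)[OF G ab] ab by (simp_all add: insert_commute)
  then consider "{a, b} = {x, y}" | "a = x" "b \<noteq> x" "b \<noteq> y" | "a = y" "b \<noteq> x" "b \<noteq> y"
    | "b = x" "a \<noteq> x" "a \<noteq> y" | "b = y" "a \<noteq> x" "a \<noteq> y" | "a \<notin> {x, y}" "b \<notin> {x, y}"
    by blast
  then show ?thesis
  proof cases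
    case 1
    then show ?thesis
      using ab by (metis doubleton_eq_iff transpose_apply_first transpose_apply_second)
  next
    case 2
    then show ?thesis
      using twin[OF twins, of b] ab by simp
  next
    case 3
    then show ?thesis
      using twin[OF twins[symmetric], of b] ab by simp
  next
    case 4
    then show ?thesis
      using twin[OF twins, of a] ba by (simp add: insert_commute)
  next
    case 5
    then show ?thesis
      using twin[OF twins[symmetric], of a] ba by (simp add: insert_commute)
  next
    case 6
    then show ?thesis
      using ab by simp
  qed
qed

text \<open>Precomposition with the transposition is an involution on proper colourings that keeps
  the monomial. It fixes \<open>w\<close>, so it trades the condition at \<open>x\<close> for the
  one at \<open>y\<close>.\<close>

lemma card_colourings_twins:
  assumes G: "simple_graph G" and twins: "closed_nbhd G x = closed_nbhd G y"
    and xy: "x \<in> verts G" "y \<in> verts G" and w: "w \<noteq> x" "w \<noteq> y"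
  shows "card {\<kappa> \<in> proper_colourings G. \<kappa> x = \<kappa> w \<and> colouring_monomial G \<kappa> = m} =
    card {\<kappa> \<in> proper_colourings G. \<kappa> y = \<kappa> w \<and> colouring_monomial G \<kappa> = m}"
proof -
  let ?t = "transpose x y"
  have proper: "\<kappa> \<circ> ?t \<in> proper_colourings G" if \<kappa>: "\<kappa> \<in> proper_colourings G" for \<kappa>
  proof -
    have "\<kappa> (?t a) \<noteq> \<kappa> (?t b)" if "{a, b} \<in> edges G" for a b
      using \<kappa> transpose_twins_edge[OF G twins that] by (auto simp: proper_colourings_def)
    \<comment> \<open>No \<open>restrict\<close> is needed here: the transposition fixes every point
      outside the vertex set.\<close>
    moreover have "\<kappa> \<circ> ?t \<in> verts G \<rightarrow>\<^sub>E UNIV"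
      using \<kappa> xy by (auto simp: proper_colourings_def PiE_iff extensional_def transpose_def)
    ultimately show ?thesis
      by (auto simp: proper_colourings_def)
  qed
  have mono: "colouring_monomial G (\<kappa> \<circ> ?t) = colouring_monomial G \<kappa>" for \<kappa> :: "'a \<Rightarrow> num"
  proof -
    have "image_mset ?t (mset_set (verts G)) = mset_set (verts G)"
      using xy by (simp add: image_mset_mset_set)
    then show ?thesis
      unfolding colouring_monomial_def by (metis multiset.map_comp)
  qed
  have "bij_betw (\<lambda>\<kappa>. \<kappa> \<circ> ?t)
      {\<kappa> \<in> proper_colourings G. \<kappa> x = \<kappa> w \<and> colouring_monomial G \<kappa> = m}
      {\<kappa> \<in> proper_colourings G. \<kappa> y = \<kappa> w \<and> colouring_monomial G \<kappa> = m}"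
    by (rule bij_betwI[where g = "\<lambda>\<kappa>. \<kappa> \<circ> ?t"])
      (use w in \<open>auto simp: mono proper simp flip: comp_def\<close>)
  then show ?thesis
    by (rule bij_betw_same_card)
qed

lemma chromatic_symmetric_function_add_edge:
  assumes "simple_graph G"
  shows "chromatic_symmetric_function (add_edge G v w) m = chromatic_symmetric_function G m -
    of_nat (card {\<kappa> \<in> proper_colourings G. \<kappa> v = \<kappa> w \<and> colouring_monomial G \<kappa> = m})"
proof -
  let ?A = "{\<kappa> \<in> proper_colourings G. colouring_monomial G \<kappa> = m}"
  let ?B = "{\<kappa> \<in> proper_colourings G. \<kappa> v = \<kappa> w \<and> colouring_monomial G \<kappa> = m}"
  have "{\<kappa> \<in> proper_colourings (add_edge G v w). colouring_monomial (add_edge G v w) \<kappa> = m} = ?A - ?B"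
    by (auto simp: proper_colourings_add_edge colouring_monomial_def)
  moreover have "finite ?A" "?B \<subseteq> ?A"
    using assms finite_colourings_of_monomial by auto
  ultimately show ?thesis
    by (simp add: chromatic_symmetric_function_def card_Diff_subset finite_subset of_nat_diff card_mono)
qed

section \<open>Interpolation in a progression and positivity\<close>

lemma arithmetic_progression_in_nth:
  assumes "arithmetic_progression_in S k a" "j \<le> k" "k \<ge> 1"
  shows "a j = scale (1 - of_nat j / of_nat k) (a 0) + scale (of_nat j / of_nat k) (a k)"
proof -
  obtain D where D: "\<And>j. j < k \<Longrightarrow> a (Suc j) - a j = D"
    using assms(1) by (auto simp: arithmetic_progression_in_def)
  \<comment> \<open>The instance \<open>i = k\<close> lets \<open>D\<close> be eliminated in favour
    of \<open>a 0\<close> and \<open>a k\<close>.\<close>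
  have nth: "a i = a 0 + scale (of_nat i) D" if "i \<le> k" for i
    using that
  proof (induction i)
    case (Suc i)
    then have "a (Suc i) = a i + D"
      using D[of i] by (simp add: algebra_simps)
    then show ?case
      using Suc by (simp add: scale_def fun_eq_iff algebra_simps)
  qed (simp add: scale_def fun_eq_iff)
  show ?thesis
    using nth[OF assms(2)] nth[of k] assms(3) by (simp add: scale_def fun_eq_iff field_simps)
qed

text \<open>Coordinates in a basis are linear on its span, which is all of
  \<open>Sym\<close>.\<close>

lemma basis_positive_convex:
  assumes b: "Sym_basis b" and f: "basis_positive b f" and g: "basis_positive b g"
    and c: "c \<ge> 0" "d \<ge> 0"
  shows "basis_positive b (scale c f + scale d g)"
proof -
  have ind: "ps.independent (b ` partitions)" and span: "ps.span (b ` partitions) = Sym"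
    using b by (auto simp: Sym_basis_def)
  have fg: "f \<in> Sym" "g \<in> Sym"
    using f g by (auto simp: basis_positive_def)
  then have "ps.representation (b ` partitions) (scale c f + scale d g) =
    (\<lambda>u. c * ps.representation (b ` partitions) f u + d * ps.representation (b ` partitions) g u)"
    using ind span subspace_Sym
    by (simp add: ps.representation_add ps.representation_scale ps.subspace_scale)
  then show ?thesis
    using f g c fg subspace_Sym
    by (auto simp: basis_positive_def ps.subspace_add ps.subspace_scale simp del: plus_fun_apply)
qed

theorem proposition3p1:
  fixes G :: "'a graph" and k :: nat and v :: "nat \<Rightarrow> 'a" and w :: 'a
    and H :: "nat \<Rightarrow> 'a graph"
  assumes "simple_graph G"
    and "k \<ge> 1"
    and "\<forall>i\<in>{1..k}. v i \<in> verts G"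
    and "inj_on v {1..k}"
    and "\<forall>i\<in>{1..k}. \<forall>j\<in>{1..k}. closed_nbhd G (v i) = closed_nbhd G (v j)"
    and "w \<in> verts G"
    and "\<forall>i\<in>{1..k}. w \<noteq> v i"
    and "\<forall>i\<in>{1..k}. w \<notin> nbhd G (v i)"
    and "H 0 = G"
    and "\<forall>j\<in>{1..k}. H j = add_edge (H (j - 1)) (v j) w"
  shows "arithmetic_progression_in Sym k (\<lambda>j. chromatic_symmetric_function (H j)) \<and>
    (\<forall>b. Sym_basis b \<longrightarrow>
       basis_positive b (chromatic_symmetric_function (H 0)) \<longrightarrow>
       basis_positive b (chromatic_symmetric_function (H k)) \<longrightarrow>
       (\<forall>j\<le>k. basis_positive b (chromatic_symmetric_function (H j))))"
proof -
  have G: "simple_graph G" and k: "k \<ge> 1" by fact+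
  define X where "X j = chromatic_symmetric_function (H j)" for j
  have H_Suc: "H (Suc j) = add_edge (H j) (v (Suc j)) w" if "j < k" for j
    using assms(10) that by force
  \<comment> \<open>Describing the colourings of \<open>H j\<close> inside those of \<open>G\<close>
    lets all later counting take place in \<open>G\<close>, where the twin symmetry holds.\<close>
  have H: "verts (H j) = verts G \<and> simple_graph (H j) \<and>
      proper_colourings (H j) = {\<kappa> \<in> proper_colourings G. \<forall>i\<in>{1..j}. \<kappa> (v i) \<noteq> \<kappa> w}"
    if "j \<le> k" for j
    using that
  proof (induction j)
    case 0
    then show ?case
      using assms(9) G by simp
  next
    case (Suc j)
    then have IH: "verts (H j) = verts G" "simple_graph (H j)"
      "proper_colourings (H j) = {\<kappa> \<in> proper_colourings G. \<forall>i\<in>{1..j}. \<kappa> (v i) \<noteq> \<kappa> w}"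
      by simp_all
    have "v (Suc j) \<in> verts G" "w \<noteq> v (Suc j)"
      using assms(3,7) Suc.prems by auto
    then have "simple_graph (H (Suc j))"
      using H_Suc[of j] Suc.prems IH assms(6) by (simp add: simple_graph_add_edge)
    then show ?case
      using H_Suc[of j] Suc.prems IH
      by (auto simp: proper_colourings_add_edge atLeastAtMostSuc_conv)
  qed
  \<comment> \<open>Counting at \<open>v 1\<close> instead of \<open>v (Suc j)\<close> makes the
    right-hand side visibly independent of \<open>j\<close>.\<close>
  have lost: "X (Suc j) m - X j m =
      - of_nat (card {\<kappa> \<in> proper_colourings G. \<kappa> (v 1) = \<kappa> w \<and> colouring_monomial G \<kappa> = m})"
    if j: "j < k" for j m
  proof -
    have distinct: "\<kappa> (v i) \<noteq> \<kappa> (v (Suc j))"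
      if "\<kappa> \<in> proper_colourings G" "i \<in> {1..j}" for \<kappa> i
    proof -
      have "v i \<noteq> v (Suc j)"
        using inj_onD[OF assms(4), of i "Suc j"] that(2) j by auto
      then have "{v i, v (Suc j)} \<in> edges G"
        using assms(5) that(2) j by (intro adjacent_twins) auto
      then show ?thesis
        using that(1) by (auto simp: proper_colourings_def)
    qed
    have "{\<kappa> \<in> proper_colourings (H j). \<kappa> (v (Suc j)) = \<kappa> w \<and> colouring_monomial (H j) \<kappa> = m} =
        {\<kappa> \<in> proper_colourings G. \<kappa> (v (Suc j)) = \<kappa> w \<and> colouring_monomial G \<kappa> = m}"
    proof (rule Collect_cong)
      fix \<kappa> :: "'a \<Rightarrow> num"
      \<comment> \<open>The constraints from the edges added earlier hold automatically, since
        \<open>w\<close> shares the colour of \<open>v (Suc j)\<close>, a neighbour of each earlier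
        \<open>v i\<close>.\<close>
      have "\<forall>i\<in>{1..j}. \<kappa> (v i) \<noteq> \<kappa> w" if "\<kappa> \<in> proper_colourings G" "\<kappa> (v (Suc j)) = \<kappa> w"
        using distinct[OF that(1)] that(2) by metis
      then show "\<kappa> \<in> proper_colourings (H j) \<and> \<kappa> (v (Suc j)) = \<kappa> w \<and> colouring_monomial (H j) \<kappa> = m \<longleftrightarrow>
          \<kappa> \<in> proper_colourings G \<and> \<kappa> (v (Suc j)) = \<kappa> w \<and> colouring_monomial G \<kappa> = m"
        using H[of j] j unfolding colouring_monomial_def by auto
    qed
    moreover have "card {\<kappa> \<in> proper_colourings G. \<kappa> (v (Suc j)) = \<kappa> w \<and> colouring_monomial G \<kappa> = m} =
        card {\<kappa> \<in> proper_colourings G. \<kappa> (v 1) = \<kappa> w \<and> colouring_monomial G \<kappa> = m}"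
      using assms(3,5,7) j k by (intro card_colourings_twins G) auto
    ultimately show ?thesis
      using H[of j] j
      by (simp add: X_def H_Suc chromatic_symmetric_function_add_edge)
  qed
  have Sym: "X j \<in> Sym" if "j \<le> k" for j
    using H[OF that] by (simp add: X_def chromatic_symmetric_function_in_Sym)
  \<comment> \<open>The first difference serves as the common one; \<open>k \<ge> 1\<close> ensures
    that it belongs to the progression.\<close>
  define D where "D = X 1 - X 0"
  have "D \<in> Sym"
    using Sym[of 0] Sym[of 1] k ps.subspace_diff[OF subspace_Sym] unfolding D_def by blast
  moreover have "X (Suc j) - X j = D" if "j < k" for j
    using lost[OF that] lost[of 0] k by (simp add: D_def fun_eq_iff)
  ultimately have ap: "arithmetic_progression_in Sym k X"
    using Sym unfolding arithmetic_progression_in_def by blast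
  have "basis_positive b (X j)"
    if "Sym_basis b" "basis_positive b (X 0)" "basis_positive b (X k)" "j \<le> k" for b j
    unfolding arithmetic_progression_in_nth[OF ap that(4) k]
    using that by (intro basis_positive_convex) (auto simp: divide_le_eq_1)
  then show ?thesis
    using ap by (simp add: X_def[abs_def])
qed

end
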